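(* Let $m\ge 2$ be an integer and $e=(3^h+1)/2$, where $1\le h\le m-1$. Then the ternary cyclic code $\mathcal{C}_{(1,e)}$ has parameters $[3^m-1,\,3^m-1-2m,\,4]$ if and only if $h$ is odd and $\gcd(m,h)=1$, i.e., if and only if $x^e$ is planar over $\mathrm{GF}(3^m)$.
   Context: Let $q=3^m$, $n=q-1$, $\alpha$ a generator of $\mathrm{GF}(q)^*$, and $m_a(x)$ the minimal polynomial of $a\in\mathrm{GF}(q)$ over $\mathrm{GF}(3)$. $C_j$ denotes the $3$-cyclotomic coset modulo $n$ containing $j$, i.e. $\{j,3j,3^2j,\dots\}$ mod $n$. For $1<e<q-1$ with $e\notin C_1$, $\mathcal{C}_{(1,e)}$ is the cyclic code of length $n$ over $\mathrm{GF}(3)$ with generator polynomial $m_\alpha(x)m_{\alpha^e}(x)$. A function $f$ on $\mathrm{GF}(q)$ is planar if for every $a\in\mathrm{GF}(q)^*$ and $b\in\mathrm{GF}(q)$ the equation $f(x+a)-f(x)=b$ has at most one solution $x\in\mathrm{GF}(q)$. *)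

theory Defs
  imports "HOL-Computational_Algebra.Polynomial"
begin

text \<open>The finite field GF(q), q = 3^m, is modelled as a finite field type 'a with
  CARD('a) = 3^m.  Its prime subfield GF(3) is the image of the naturals.\<close>

definition GF3 :: "'a::field set" where
  "GF3 = range of_nat"

definition over_GF3 :: "'a::field poly \<Rightarrow> bool" where
  "over_GF3 p \<longleftrightarrow> (\<forall>i. coeff p i \<in> GF3)"

definition minpoly3 :: "'a::field \<Rightarrow> 'a poly" where
  "minpoly3 a = (ARG_MIN degree p. lead_coeff p = 1 \<and> over_GF3 p \<and> poly p a = 0)"

definition cyclic_code :: "nat \<Rightarrow> 'a::field poly \<Rightarrow> 'a list set" where
  "cyclic_code n g = {c. length c = n \<and> set c \<subseteq> GF3 \<and>
      (\<exists>q. over_GF3 q \<and> Poly c = g * q)}"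

definition code_1e :: "nat \<Rightarrow> 'a::field \<Rightarrow> nat \<Rightarrow> 'a list set" where
  "code_1e n \<alpha> e = cyclic_code n (minpoly3 \<alpha> * minpoly3 (\<alpha> ^ e))"

definition hweight :: "'a::zero list \<Rightarrow> nat" where
  "hweight c = length (filter (\<lambda>x. x \<noteq> 0) c)"

definition min_dist :: "'a::zero list set \<Rightarrow> nat" where
  "min_dist C = Min {hweight c | c. c \<in> C \<and> c \<noteq> replicate (length c) 0}"

definition has_params3 :: "'a::zero list set \<Rightarrow> nat \<Rightarrow> nat \<Rightarrow> nat \<Rightarrow> bool" where
  "has_params3 C n k d \<longleftrightarrow> (\<forall>c\<in>C. length c = n) \<and> card C = 3 ^ k \<and> min_dist C = d"

definition planar :: "('a::{finite,field} \<Rightarrow> 'a) \<Rightarrow> bool" where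
  "planar f \<longleftrightarrow> (\<forall>a b. a \<noteq> 0 \<longrightarrow> card {x. f (x + a) - f x = b} \<le> 1)"

end

theory Submission
  imports "HOL-Algebra.Algebraic_Closure_Type" "HOL-Number_Theory.Residues" Defs
begin

text \<open>
  Let \<open>Q = 3\<^sup>h\<close>. Over the algebraic closure every \<open>x\<close> has the form \<open>(w - 1)\<^sup>2 / w\<close>, and then
  \<open>(x + 1)\<^sup>e - x\<^sup>e = 2 (w\<^sup>k + 1/w\<^sup>k)\<close> with \<open>k = (Q - 1) / 2\<close>, where \<open>w\<close> lies in \<open>GF(9\<^sup>m)\<close>. If \<open>h\<close> is odd
  and coprime to \<open>m\<close>, then \<open>k\<close> is coprime to \<open>9\<^sup>m - 1\<close>, so this value determines \<open>w\<close> up to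
  inversion and hence \<open>x\<close>: the power map is planar.

  For planar \<open>x\<^sup>e\<close> with \<open>e\<close> even, a codeword of weight at most \<open>3\<close> amounts to \<open>x + y + z = 0\<close> or
  \<open>x = y + z\<close> together with the same relation for the \<open>e\<close>-th powers, which planarity excludes.
  Planarity also makes \<open>x \<mapsto> (x + a)\<^sup>e - x\<^sup>e\<close> surjective for \<open>a \<noteq> 0\<close>, and solving
  \<open>x - y = 1 + v\<close>, \<open>x\<^sup>e - y\<^sup>e = 1 + v\<^sup>e\<close> gives a nonzero codeword of weight at most \<open>4\<close>.

  Conversely, if \<open>h\<close> is even then \<open>e\<close> is odd and the positions \<open>1\<close>, \<open>-1\<close> carry a codeword of
  weight \<open>2\<close>; if \<open>g = gcd m h > 1\<close>, then \<open>x\<^sup>e = x\<close> on the squares of \<open>GF(3\<^sup>g)\<close>, and two consecutive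
  nonzero squares give a nonzero codeword of weight at most \<open>3\<close>.
\<close>

section \<open>Fields of characteristic three\<close>

lemma CHAR_three:
  assumes "card (UNIV :: 'a::{finite,field} set) = 3 ^ m"
  shows "CHAR('a) = 3"
proof -
  have "Factorial_Ring.prime CHAR('a)"
    using finite_imp_CHAR_pos[OF finite_UNIV] prime_CHAR_semidom by blast
  moreover have "CHAR('a) dvd 3 ^ m"
    using CHAR_dvd_CARD[where 'a='a] assms by simp
  ultimately show ?thesis
    using primes_dvd_imp_eq[OF _ _ prime_dvd_power, of "CHAR('a)" 3 m] by simp
qed

text \<open>Multiplication by \<open>x\<close> permutes the nonzero elements, so their product
  absorbs a factor \<open>x\<close> to the power of their number; that product is nonzero and
  cancels.\<close>

lemma finite_field_power_card:
  fixes x :: "'a::{finite,field}"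
  shows "x ^ card (UNIV :: 'a set) = x"
proof (cases "x = 0")
  case False
  have "x * (\<Prod>y\<in>UNIV-{0}. x * y) = x * x ^ (card (UNIV :: 'a set) - 1) * \<Prod>(UNIV-{0})"
    by (simp add: prod.distrib mult_ac)
  also have "x * x ^ (card (UNIV :: 'a set) - 1) = x ^ card (UNIV :: 'a set)"
    by (subst power_Suc[symmetric]) (simp add: Suc_leI card_gt_0_iff)
  also have "(\<Prod>y\<in>UNIV-{0}. x * y) = (\<Prod>y\<in>UNIV-{0}. y)"
    by (rule prod.reindex_bij_witness[of _ "\<lambda>y. y / x" "\<lambda>y. x * y"]) (use False in auto)
  finally show ?thesis by simp
qed (simp add: zero_power card_gt_0_iff)

lemma three_eq_0:
  assumes "CHAR('a::comm_ring_1) = 3"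
  shows "(3::'a) = 0"
  by (metis assms of_nat_CHAR of_nat_numeral)

lemma two_eq_minus_1:
  assumes "CHAR('a::comm_ring_1) = 3"
  shows "(2::'a) = -1"
  using three_eq_0[OF assms] by (simp add: eq_neg_iff_add_eq_0)

lemma add_power_3:
  fixes x y :: "'a::comm_ring_1"
  assumes "CHAR('a) = 3"
  shows "(x + y) ^ (3 ^ i) = x ^ (3 ^ i) + y ^ (3 ^ i)"
  by (rule freshmans_dream') (simp_all add: assms)

lemma diff_power_3:
  fixes x y :: "'a::comm_ring_1"
  assumes "CHAR('a) = 3"
  shows "(x - y) ^ (3 ^ i) = x ^ (3 ^ i) - y ^ (3 ^ i)"
  using add_power_3[OF assms, of x "-y" i] by simp

lemma GF3_eq:
  assumes "CHAR('a::field) = 3"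
  shows "(GF3 :: 'a set) = {0, 1, -1}"
proof -
  have "of_nat n \<in> {0, 1, -1 :: 'a}" for n
  proof -
    have "(of_nat n :: 'a) = of_nat (n mod 3)"
      using assms by (simp add: of_nat_eq_iff_cong_CHAR cong_def)
    moreover have "n mod 3 \<in> {0, 1, 2}" by auto
    ultimately show ?thesis using two_eq_minus_1[OF assms] by auto
  qed
  moreover have "{0, 1, -1} \<subseteq> (GF3 :: 'a set)"
    using two_eq_minus_1[OF assms] unfolding GF3_def
    by (metis empty_subsetI insert_subset of_nat_0 of_nat_1 of_nat_numeral rangeI)
  ultimately show ?thesis by (auto simp: GF3_def)
qed

text \<open>The prime field is the fixed set of Frobenius. In this form, closure properties follow
  from additivity and multiplicativity of cubing.\<close>

lemma GF3_iff:
  assumes "CHAR('a::field) = 3"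
  shows "(x::'a) \<in> GF3 \<longleftrightarrow> x ^ 3 = x"
proof -
  have "x ^ 3 = x \<longleftrightarrow> x * (x - 1) * (x + 1) = 0"
    by (simp add: algebra_simps power3_eq_cube)
  also have "\<dots> \<longleftrightarrow> x \<in> {0, 1, -1}"
    by (auto simp: eq_neg_iff_add_eq_0)
  finally show ?thesis using GF3_eq[OF assms] by simp
qed

lemma card_GF3:
  assumes "CHAR('a::field) = 3"
  shows "card (GF3 :: 'a set) = 3"
proof -
  have "(1::'a) \<noteq> -1" 
    using two_eq_minus_1[OF assms] by (metis add.inverse_inverse add_cancel_left_left neg_equal_0_iff_equal one_add_one one_neq_zero)
  thus ?thesis by (simp add: GF3_eq[OF assms])
qed

section \<open>The power map\<close>

text \<open>Bezout: with \<open>a * x = b * y + 1\<close>, iterating the first Frobenius power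
  \<open>x\<close> times and the second \<open>y\<close> times leaves exactly one cubing.\<close>

lemma power_3_fixed_gcd:
  fixes u :: "'a::field"
  assumes "u ^ (3 ^ a) = u" and "u ^ (3 ^ b) = u" and "coprime a b" and "a \<noteq> 0"
  shows "u ^ 3 = u"
proof -
  have iter: "u ^ (3 ^ (c * n)) = u" if "u ^ (3 ^ c) = u" for c n
    by (induction n) (simp_all add: power_add power_mult that)
  obtain x y where "a * x = b * y + 1"
    using bezout_nat[OF \<open>a \<noteq> 0\<close>, of b] assms(3) by (auto simp: coprime_iff_gcd_eq_1)
  hence "u ^ (3 ^ (b * y + 1)) = u" using iter[OF assms(1), of x] by simp
  moreover have "u ^ (3 ^ (b * y + 1)) = (u ^ (3 ^ (b * y))) ^ 3"
    by (simp only: power_add power_mult power_one_right)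
  ultimately show ?thesis using iter[OF assms(2), of y] by simp
qed

lemma three_power_odd_mod_4:
  assumes "odd h"
  shows "(3::nat) ^ h mod 4 = 3"
proof -
  obtain j where "h = 2 * j + 1" using assms oddE by blast
  moreover have "(9::nat) ^ j mod 4 = 1" by (induction j) (auto simp: mod_mult_right_eq[symmetric])
  ultimately show ?thesis
    by (simp add: power_mult) presburger
qed

text \<open>Writing \<open>x = (w - 1)\<^sup>2 / w\<close> and \<open>x + 1 = (w + 1)\<^sup>2 / w\<close> turns the
  difference \<open>(x + 1)\<^sup>e - x\<^sup>e\<close> into \<open>2 (w\<^sup>k + w\<^sup>-\<^sup>k)\<close>.\<close>
lemma diff_quotient_param:
  fixes x w :: "'a::field"
  assumes c: "CHAR('a) = 3" and w: "w ^ 2 - (x - 1) * w + 1 = 0" and k: "3 ^ h = 2 * k + 1"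
  shows "w \<noteq> 0" and "w ^ k * ((x + 1) ^ (k + 1) - x ^ (k + 1)) = 2 * (w ^ (2 * k) + 1)"
proof -
  show w0: "w \<noteq> 0" using w by auto
  have three: "(3::'a) = 0" using three_eq_0[OF c] .
  have "(w + 1) ^ 2 = w * (x + 1) + (w ^ 2 - (x - 1) * w + 1)"
    by (simp add: algebra_simps power2_eq_square)
  hence p: "(w + 1) ^ 2 = w * (x + 1)" using w by simp
  have "(w - 1) ^ 2 = w * x + (w ^ 2 - (x - 1) * w + 1) - 3 * w"
    by (simp add: algebra_simps power2_eq_square)
  hence q: "(w - 1) ^ 2 = w * x" using w three by simp
  \<comment> \<open>The \<open>(k + 1)\<close>-th powers of the squares in \<open>p\<close> and
    \<open>q\<close> thus become \<open>(3 ^ h + 1)\<close>-th powers, which Frobenius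
    expands.\<close>
  have e: "2 * (k + 1) = 3 ^ h + 1" using k by simp
  have "w ^ (k + 1) * ((x + 1) ^ (k + 1) - x ^ (k + 1)) = (w * (x + 1)) ^ (k + 1) - (w * x) ^ (k + 1)"
    by (simp only: power_mult_distrib right_diff_distrib)
  also have "\<dots> = (w + 1) ^ (3 ^ h + 1) - (w - 1) ^ (3 ^ h + 1)"
    by (simp only: p[symmetric] q[symmetric] power_mult[symmetric] e)
  also have "\<dots> = (w ^ (3 ^ h) + 1) * (w + 1) - (w ^ (3 ^ h) - 1) * (w - 1)"
    using add_power_3[OF c, of w 1 h] diff_power_3[OF c, of w 1 h]
    by (simp add: power_add)
  also have "\<dots> = w * (2 * (w ^ (2 * k) + 1))"
    by (simp add: k algebra_simps)
  finally show "w ^ k * ((x + 1) ^ (k + 1) - x ^ (k + 1)) = 2 * (w ^ (2 * k) + 1)"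
    using w0 by simp
qed

text \<open>The quadratic has coefficients fixed by the \<open>3 ^ m\<close>-power map, so that map
  sends \<open>w\<close> to \<open>w\<close> or to the other root \<open>1 / w\<close>; applied
  twice it is the identity on \<open>w\<close>.\<close>

lemma param_frobenius_fixed:
  fixes x w :: "'a::field"
  assumes c: "CHAR('a) = 3" and w: "w ^ 2 - (x - 1) * w + 1 = 0" and x: "x ^ (3 ^ m) = x"
  shows "w ^ (3 ^ (2 * m)) = w"
proof -
  define v where "v = w ^ (3 ^ m)"
  have w0: "w \<noteq> 0" using w by auto
  have "(w ^ 2 - (x - 1) * w + 1) ^ (3 ^ m) = v ^ 2 - (x - 1) * v + 1"
    by (simp add: add_power_3[OF c] diff_power_3[OF c] power_mult_distrib x v_def
        power_mult[symmetric] mult.commute)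
  hence v: "v ^ 2 - (x - 1) * v + 1 = 0" using w by (simp add: zero_power)
  \<comment> \<open>This combination eliminates \<open>x\<close> from the two quadratic
    equations.\<close>
  have "(v - w) * (v * w - 1) = w * (v ^ 2 - (x - 1) * v + 1) - v * (w ^ 2 - (x - 1) * w + 1)"
    by (simp add: algebra_simps power2_eq_square)
  hence "v = w \<or> v * w = 1" using v w by simp
  moreover have "w ^ (3 ^ (2 * m)) = v ^ (3 ^ m)"
    by (simp add: v_def mult_2 power_add power_mult)
  moreover have "v ^ (3 ^ m) = w" if "v * w = 1"
  proof -
    have "v ^ (3 ^ m) * v = 1"
      using arg_cong[OF that, of "\<lambda>z. z ^ (3 ^ m)"] by (simp add: power_mult_distrib v_def)
    thus ?thesis using that by (metis mult.commute mult_cancel_right mult_zero_left zero_neq_one)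
  qed
  ultimately show ?thesis by (auto simp: v_def)
qed

text \<open>Equal differences give equal values of \<open>w ^ k + 1 / w ^ k\<close>, hence equal
  \<open>w ^ k\<close> up to inversion. Injectivity of the \<open>k\<close>-th power on the relevant
  elements carries this over to \<open>w\<close>. An algebraically closed field supplies the
  parameter \<open>w\<close> for every \<open>x\<close>.\<close>

lemma diff_quotient_inj:
  fixes x y :: "'a::alg_closed_field"
  assumes c: "CHAR('a) = 3" and h: "odd h" "coprime m h" and k: "3 ^ h = 2 * k + 1"
    and x: "x ^ (3 ^ m) = x" and y: "y ^ (3 ^ m) = y"
    and eq: "(x + 1) ^ (k + 1) - x ^ (k + 1) = (y + 1) ^ (k + 1) - y ^ (k + 1)"
  shows "x = y"
proof -
  have root: "\<exists>w. w ^ 2 - (z - 1) * w + 1 = 0" for z :: 'a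
    using alg_closed_imp_poly_has_root[of "[:1, -(z - 1), 1:]"]
    by (auto simp: power2_eq_square algebra_simps)
  obtain w where w: "w ^ 2 - (x - 1) * w + 1 = 0" using root by blast
  obtain v where v: "v ^ 2 - (y - 1) * v + 1 = 0" using root by blast
  note wp = diff_quotient_param[OF c w k] and vp = diff_quotient_param[OF c v k]
  have "odd k" using three_power_odd_mod_4[OF h(1)] k by presburger
  have inj: "w = z" if z: "z ^ (3 ^ (2 * m)) = z" "z \<noteq> 0" "w ^ k = z ^ k" for z
  proof -
    define u where "u = w / z"
    have uk: "u ^ k = 1" using z by (simp add: u_def power_divide)
    have "u ^ (3 ^ h) = u" by (simp add: k power_add mult_2 uk)
    moreover have "u ^ (3 ^ (2 * m)) = u"
      using param_frobenius_fixed[OF c w x] z by (simp add: u_def power_divide)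
    \<comment> \<open>Oddness of \<open>h\<close> is what extends coprimality from \<open>m\<close>
      to \<open>2 * m\<close>, as \<open>w\<close> is fixed only by the
      \<open>3 ^ (2 * m)\<close>-power map.\<close>
    moreover have "coprime h (2 * m)" "h \<noteq> 0"
      using h by (auto simp: coprime_commute odd_pos)
    ultimately have "u ^ 3 = u" by (rule power_3_fixed_gcd)
    moreover have "u \<noteq> 0" using uk \<open>odd k\<close> by (cases k) auto
    ultimately have "u ^ 2 = 1" by (simp add: power3_eq_cube power2_eq_square)
    \<comment> \<open>At this point \<open>u\<close> is \<open>1\<close> or \<open>-1\<close>; an
      odd \<open>k\<close> with \<open>u ^ k = 1\<close> rules out \<open>-1\<close>.\<close>
    moreover obtain j where "k = 2 * j + 1" using \<open>odd k\<close> oddE by blast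
    ultimately have "u = 1" using uk by (simp add: power_mult)
    thus ?thesis using z by (simp add: u_def)
  qed
  define D where "D = (x + 1) ^ (k + 1) - x ^ (k + 1)"
  have "w ^ k * D = 2 * ((w ^ k) ^ 2 + 1)" "v ^ k * D = 2 * ((v ^ k) ^ 2 + 1)"
    using wp(2) vp(2) eq by (simp_all add: D_def power_mult[symmetric] mult.commute)
  moreover have "v ^ k * (w ^ k * D) = w ^ k * (v ^ k * D)"
    by (rule mult.left_commute)
  ultimately have "v ^ k * (2 * ((w ^ k) ^ 2 + 1)) - w ^ k * (2 * ((v ^ k) ^ 2 + 1)) = 0"
    by simp
  moreover have "v ^ k * (2 * ((w ^ k) ^ 2 + 1)) - w ^ k * (2 * ((v ^ k) ^ 2 + 1))
      = 2 * ((w ^ k - v ^ k) * (w ^ k * v ^ k - 1))"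
    by (simp add: algebra_simps power2_eq_square)
  ultimately have "w ^ k = v ^ k \<or> w ^ k * v ^ k = 1"
    using two_eq_minus_1[OF c] by simp
  hence "w = v \<or> w = 1 / v"
  proof
    assume "w ^ k = v ^ k"
    thus ?thesis using inj param_frobenius_fixed[OF c v y] vp(1) by blast
  next
    assume "w ^ k * v ^ k = 1"
    hence "w ^ k = (1 / v) ^ k" using vp(1) by (simp add: field_simps)
    thus ?thesis using inj[of "1 / v"] param_frobenius_fixed[OF c v y] vp(1)
      by (simp add: power_divide)
  qed
  \<comment> \<open>This expression is symmetric under inversion of the parameter, so either
    alternative gives \<open>x = y\<close>.\<close>
  moreover have "x = w + 1 / w + 1" "y = v + 1 / v + 1"
    using w v wp(1) vp(1) by (simp_all add: field_simps power2_eq_square)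
  ultimately show ?thesis by auto
qed

text \<open>Homogeneity reduces every shift \<open>a\<close> to the shift \<open>1\<close>; the
  embedding \<open>to_ac\<close> then moves the injectivity question into the algebraic
  closure.\<close>

lemma planar_power:
  fixes m h e :: nat
  assumes card: "card (UNIV :: 'a::{finite,field} set) = 3 ^ m"
    and h: "odd h" "coprime m h" and e: "e = (3 ^ h + 1) div 2"
  shows "planar (\<lambda>x::'a. x ^ e)"
proof -
  note c = CHAR_three[OF card]
  define k where "k = e - 1"
  have "odd ((3::nat) ^ h)" by simp
  hence k: "3 ^ h = 2 * k + 1" and ek: "e = k + 1"
    unfolding k_def e by presburger+
  have inj: "x = y" if "(x + 1) ^ e - x ^ e = (y + 1) ^ e - y ^ e" for x y :: 'a
  proof -
    have "to_ac x = to_ac y"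
    proof (rule diff_quotient_inj[OF _ h(1) _ k])
      show "to_ac x ^ 3 ^ m = to_ac x" "to_ac y ^ 3 ^ m = to_ac y"
        using finite_field_power_card[of x] finite_field_power_card[of y] by (simp_all add: card flip: to_ac_power)
      show "(to_ac x + 1) ^ (k + 1) - to_ac x ^ (k + 1) = (to_ac y + 1) ^ (k + 1) - to_ac y ^ (k + 1)"
        using arg_cong[OF that, of to_ac] by (simp add: ek)
    qed (use c h(2) in simp_all)
    thus ?thesis by simp
  qed
  have scale: "(x + a) ^ e - x ^ e = a ^ e * ((x / a + 1) ^ e - (x / a) ^ e)" if "a \<noteq> 0" for x a :: 'a
  proof -
    have "x + a = a * (x / a + 1)" "x = a * (x / a)" using that by (simp_all add: field_simps)
    thus ?thesis by (metis power_mult_distrib right_diff_distrib)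
  qed
  show ?thesis unfolding planar_def
  proof (intro allI impI)
    fix a b :: 'a assume a: "a \<noteq> 0"
    have "x = y" if "(x + a) ^ e - x ^ e = b" "(y + a) ^ e - y ^ e = b" for x y
    proof -
      have "a ^ e * ((x / a + 1) ^ e - (x / a) ^ e) = a ^ e * ((y / a + 1) ^ e - (y / a) ^ e)"
        by (simp only: scale[OF a, symmetric] that)
      hence "(x / a + 1) ^ e - (x / a) ^ e = (y / a + 1) ^ e - (y / a) ^ e"
        using mult_left_cancel[OF power_not_zero[OF a]] by blast
      hence "x / a = y / a" by (rule inj)
      thus ?thesis using a by simp
    qed
    thus "card {x. (x + a) ^ e - x ^ e = b} \<le> 1"
      unfolding One_nat_def card_le_Suc0_iff_eq[OF finite] by blast
  qed
qed

section \<open>Minimal polynomials over the prime field\<close>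

text \<open>Coefficientwise cubing is multiplicative, so being over the prime field can be tested as
  invariance under it.\<close>

lemma over_GF3_iff:
  assumes "CHAR('a::field) = 3"
  shows "over_GF3 (p :: 'a poly) \<longleftrightarrow> map_poly (\<lambda>x. x ^ 3) p = p"
  by (simp add: over_GF3_def GF3_iff[OF assms] poly_eq_iff coeff_map_poly)

lemma map_poly_cube_mult:
  fixes p q :: "'a::field poly"
  assumes "CHAR('a) = 3"
  shows "map_poly (\<lambda>x. x ^ 3) (p * q) = map_poly (\<lambda>x. x ^ 3) p * map_poly (\<lambda>x. x ^ 3) q"
  by (rule poly_eqI)
     (simp add: coeff_map_poly coeff_mult power_mult_distrib freshmans_dream_sum assms)

lemma map_poly_cube_prod:
  fixes f :: "'b \<Rightarrow> 'a::field poly"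
  assumes "CHAR('a) = 3"
  shows "map_poly (\<lambda>x. x ^ 3) (\<Prod>s\<in>S. f s) = (\<Prod>s\<in>S. map_poly (\<lambda>x. x ^ 3) (f s))"
  by (induction S rule: infinite_finite_induct)
     (simp_all add: map_poly_cube_mult[OF assms] map_poly_1)

lemma poly_map_poly_cube:
  fixes p :: "'a::field poly"
  assumes "CHAR('a) = 3"
  shows "poly (map_poly (\<lambda>x. x ^ 3) p) (x ^ 3) = poly p x ^ 3"
proof -
  have "degree (map_poly (\<lambda>x. x ^ 3) p) = degree p" by (rule degree_map_poly) simp
  thus ?thesis
    by (simp add: poly_altdef coeff_map_poly freshmans_dream_sum assms power_mult_distrib
        power_mult[symmetric] mult.commute)
qed

lemma over_GF3_mult:
  assumes "CHAR('a::field) = 3" "over_GF3 (p :: 'a poly)" "over_GF3 q"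
  shows "over_GF3 (p * q)"
  using assms by (simp add: over_GF3_iff map_poly_cube_mult)

text \<open>Cubing the coefficients fixes both \<open>g\<close> and \<open>g * q\<close>, so
  \<open>g\<close> cancels. This turns divisibility over the large field into divisibility over the
  prime field.\<close>

lemma over_GF3_mult_cancel:
  assumes "CHAR('a::field) = 3" "over_GF3 (g :: 'a poly)" "over_GF3 (g * q)" "g \<noteq> 0"
  shows "over_GF3 q"
  using assms by (simp add: over_GF3_iff map_poly_cube_mult)

lemma over_GF3_root_power:
  assumes "CHAR('a::field) = 3" "over_GF3 (p :: 'a poly)" "poly p x = 0"
  shows "poly p (x ^ (3 ^ i)) = 0"
proof (induction i)
  case (Suc i)
  have "poly p ((x ^ (3 ^ i)) ^ 3) = poly p (x ^ (3 ^ i)) ^ 3"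
    using poly_map_poly_cube[OF assms(1), of p "x ^ (3 ^ i)"] assms(1,2) by (simp add: over_GF3_iff)
  thus ?case using Suc by (simp add: power_mult[symmetric] mult.commute)
qed (simp add: assms)

lemma prod_linear_dvd:
  fixes p :: "'a::field poly"
  assumes "finite S" and "\<And>s. s \<in> S \<Longrightarrow> poly p s = 0"
  shows "(\<Prod>s\<in>S. [:-s, 1:]) dvd p"
  using assms
proof (induction S)
  case (insert a S)
  then obtain q where q: "p = (\<Prod>s\<in>S. [:-s, 1:]) * q" by auto
  have "poly (\<Prod>s\<in>S. [:-s, 1:]) a \<noteq> 0"
    using insert.hyps by (auto simp: poly_prod)
  hence "poly q a = 0" using insert.prems[of a] q by simp
  then obtain r where "q = [:-a, 1:] * r" by (auto simp: poly_eq_0_iff_dvd)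
  hence "p = (\<Prod>s\<in>insert a S. [:-s, 1:]) * r"
    unfolding prod.insert[OF insert.hyps(1,2)] q by (simp only: mult_ac)
  thus ?case by (rule dvdI)
qed simp

text \<open>The Frobenius orbit of \<open>b\<close>. For a power of \<alpha>, the exponents run
  through a 3-cyclotomic coset.\<close>

definition conjugates3 :: "'a::field \<Rightarrow> 'a set" where
  "conjugates3 b = range (\<lambda>i. b ^ (3 ^ i))"

lemma conjugates3_self: "b \<in> conjugates3 b"
  using rangeI[of "\<lambda>i. b ^ (3 ^ i)" 0] by (simp add: conjugates3_def)

lemma conjugates3_cube:
  fixes b :: "'a::{finite,field}"
  assumes "CHAR('a) = 3"
  shows "bij_betw (\<lambda>x. x ^ 3) (conjugates3 b) (conjugates3 b)"
proof -
  have "inj_on (\<lambda>x. x ^ 3) (conjugates3 b)"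
  proof (rule inj_onI)
    fix x y :: 'a assume "x ^ 3 = y ^ 3"
    hence "(x - y) ^ 3 = 0" using diff_power_3[OF assms, of x y 1] by simp
    thus "x = y" by simp
  qed
  moreover have "(\<lambda>x. x ^ 3) ` conjugates3 b \<subseteq> conjugates3 b"
  proof
    fix y assume "y \<in> (\<lambda>x. x ^ 3) ` conjugates3 b"
    then obtain i where "y = b ^ (3 ^ Suc i)"
      by (auto simp: conjugates3_def power_mult[symmetric] mult.commute)
    thus "y \<in> conjugates3 b" unfolding conjugates3_def by blast
  qed
  ultimately show ?thesis
    by (simp add: bij_betw_def endo_inj_surj)
qed

text \<open>The orbit product \<open>P\<close> is Frobenius-invariant, hence a candidate in the
  degree minimisation. Any candidate vanishes on the whole orbit and is divisible by
  \<open>P\<close>, so the minimiser \<open>M\<close> equals \<open>P\<close>.\<close>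

lemma
  fixes b :: "'a::{finite,field}"
  assumes c: "CHAR('a) = 3"
  shows minpoly3_eq: "minpoly3 b = (\<Prod>s\<in>conjugates3 b. [:-s, 1:])"
    and over_GF3_minpoly3: "over_GF3 (minpoly3 b)"
proof -
  define P where "P = (\<Prod>s\<in>conjugates3 b. [:-s, 1:])"
  define M where "M = minpoly3 b"
  have "map_poly (\<lambda>x. x ^ 3) P = (\<Prod>s\<in>conjugates3 b. [:-(s ^ 3), 1:])"
    unfolding P_def map_poly_cube_prod[OF c] by (intro prod.cong) (simp_all add: map_poly_pCons)
  also have "\<dots> = P"
    unfolding P_def by (rule prod.reindex_bij_betw[OF conjugates3_cube[OF c]])
  finally have P3: "over_GF3 P" by (simp add: over_GF3_iff[OF c])
  have Pmonic: "lead_coeff P = 1" unfolding P_def by (simp add: lead_coeff_prod)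
  moreover have "poly P b = 0" using conjugates3_self[of b] by (auto simp: P_def poly_prod)
  ultimately have "is_arg_min degree (\<lambda>p. lead_coeff p = 1 \<and> over_GF3 p \<and> poly p b = 0) M"
    unfolding M_def minpoly3_def using P3 by (intro is_arg_min_arg_min_nat[where x=P]) auto
  hence M: "lead_coeff M = 1" "over_GF3 M" "poly M b = 0" and min: "degree M \<le> degree P"
    using \<open>poly P b = 0\<close> P3 Pmonic by (auto simp: is_arg_min_linorder)
  have "P dvd M" unfolding P_def
    using over_GF3_root_power[OF c M(2,3)] by (intro prod_linear_dvd) (auto simp: conjugates3_def)
  then obtain r where r: "M = P * r" by auto
  have "M \<noteq> 0" using M(1) by auto
  hence "degree r = 0" using r min by (auto simp: degree_mult_eq)
  then obtain u where "r = [:u:]" by (rule degree_eq_zeroE)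
  moreover have "lead_coeff r = 1" using M(1) Pmonic r by (simp add: lead_coeff_mult)
  ultimately have "r = 1" by simp
  hence "M = P" using r by simp
  thus "minpoly3 b = (\<Prod>s\<in>conjugates3 b. [:-s, 1:])" by (simp add: M_def P_def)
  show "over_GF3 (minpoly3 b)" using M(2) by (simp add: M_def)
qed

lemma poly_minpoly3_self:
  fixes b :: "'a::{finite,field}"
  assumes "CHAR('a) = 3"
  shows "poly (minpoly3 b) b = 0"
  unfolding minpoly3_eq[OF assms] poly_prod
  using conjugates3_self[of b] by auto

lemma monic_minpoly3:
  fixes b :: "'a::{finite,field}"
  assumes "CHAR('a) = 3"
  shows "lead_coeff (minpoly3 b) = 1"
  unfolding minpoly3_eq[OF assms] by (simp add: lead_coeff_prod)

lemma degree_minpoly3: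
  fixes b :: "'a::{finite,field}"
  assumes "CHAR('a) = 3"
  shows "degree (minpoly3 b) = card (conjugates3 b)"
  unfolding minpoly3_eq[OF assms] by (subst degree_prod_eq_sum_degree) auto

text \<open>The \<open>3 ^ m\<close>-power map is the identity, so the Frobenius exponent matters
  only modulo \<open>m\<close>.\<close>

lemma conjugates3_eq:
  fixes b :: "'a::{finite,field}"
  assumes "card (UNIV :: 'a set) = 3 ^ m" and "m > 0"
  shows "conjugates3 b = (\<lambda>i. b ^ (3 ^ i)) ` {..<m}"
proof -
  have per: "b ^ (3 ^ i) = b ^ (3 ^ (i mod m))" for i
  proof -
    have "x ^ (3 ^ (m * k)) = x" for x :: 'a and k
      using finite_field_power_card[where 'a='a]
      by (induction k) (simp_all add: power_add power_mult assms(1))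
    hence "(b ^ (3 ^ (m * (i div m)))) ^ (3 ^ (i mod m)) = b ^ (3 ^ (i mod m))" by simp
    thus ?thesis by (simp only: power_mult[symmetric] power_add[symmetric] mult_div_mod_eq)
  qed
  show ?thesis unfolding conjugates3_def
    using per assms(2) by (auto intro!: image_eqI[where x="_ mod m"])
qed

section \<open>Cyclic codes\<close>

lemma over_GF3_Poly:
  assumes "set c \<subseteq> (GF3 :: 'a::field set)"
  shows "over_GF3 (Poly c)"
proof -
  have "(0 :: 'a) \<in> GF3" using rangeI[of of_nat 0] by (simp add: GF3_def)
  thus ?thesis using assms nth_mem[of _ c] by (auto simp: over_GF3_def nth_default_def)
qed

lemma Poly_map_coeff:
  assumes "\<And>i. i \<ge> n \<Longrightarrow> coeff p i = 0"
  shows "Poly (map (coeff p) [0..<n]) = p"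
  by (rule poly_eqI) (use assms in \<open>auto simp: nth_default_def\<close>)

lemma map_coeff_Poly: "map (coeff (Poly c)) [0..<length c] = c"
  by (rule nth_equalityI) (simp_all add: nth_default_def)

text \<open>Length bounds are stated by vanishing coefficients rather than by degrees, so that the
  zero polynomial fits even when the bound is \<open>0\<close>.\<close>

lemma coeff_mult_eq_0_beyond_iff:
  fixes g p :: "'a::idom poly"
  assumes "g \<noteq> 0" "degree g \<le> n"
  shows "(\<forall>i\<ge>n. coeff (g * p) i = 0) \<longleftrightarrow> (\<forall>i\<ge>n - degree g. coeff p i = 0)"
proof (cases "p = 0")
  case False
  have vanish: "(\<forall>i\<ge>k. coeff r i = 0) \<longleftrightarrow> degree r < k" if "r \<noteq> 0" for r :: "'a poly" and k
  proof
    assume "\<forall>i\<ge>k. coeff r i = 0"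
    thus "degree r < k" using that by (metis leading_coeff_0_iff not_le)
  qed (simp add: coeff_eq_0)
  show ?thesis
    using False assms by (subst (1 2) vanish) (auto simp: degree_mult_eq)
qed simp

text \<open>Multiplication by \<open>g\<close> encodes the ternary message words of length
  \<open>n - degree g\<close> bijectively.\<close>

lemma card_cyclic_code:
  fixes g :: "'a::field poly"
  assumes c: "CHAR('a) = 3" and g: "over_GF3 g" "g \<noteq> 0" and deg: "degree g \<le> n"
  shows "card (cyclic_code n g) = 3 ^ (n - degree g)"
proof -
  define k where "k = n - degree g"
  define L where "L = {d. set d \<subseteq> (GF3 :: 'a set) \<and> length d = k}"
  define enc where "enc = (\<lambda>d. map (coeff (g * Poly d)) [0..<n])"
  have Poly_enc: "Poly (enc d) = g * Poly d" if "d \<in> L" for d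
  proof -
    have "\<forall>i\<ge>k. coeff (Poly d) i = 0" using that by (simp add: L_def nth_default_def)
    thus ?thesis unfolding enc_def k_def
      using coeff_mult_eq_0_beyond_iff[OF g(2) deg] by (intro Poly_map_coeff) blast
  qed
  have "inj_on enc L"
  proof (rule inj_onI)
    fix d d' assume d: "d \<in> L" "d' \<in> L" "enc d = enc d'"
    hence "Poly d = Poly d'" using Poly_enc g(2) by (metis mult_left_cancel)
    thus "d = d'" using d map_coeff_Poly[of d] map_coeff_Poly[of d'] by (simp add: L_def)
  qed
  moreover have "enc ` L = cyclic_code n g"
  proof (intro equalityI subsetI)
    fix x assume "x \<in> enc ` L"
    then obtain d where d: "d \<in> L" "x = enc d" by blast
    have "over_GF3 (Poly d)" using d(1) by (intro over_GF3_Poly) (auto simp: L_def)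
    moreover from this have "over_GF3 (g * Poly d)" by (rule over_GF3_mult[OF c g(1)])
    ultimately have "length x = n" "set x \<subseteq> GF3" "over_GF3 (Poly d)"
      using d(2) by (auto simp: enc_def over_GF3_def)
    thus "x \<in> cyclic_code n g"
      using Poly_enc[OF d(1)] d(2) unfolding cyclic_code_def by blast
  next
    fix x assume "x \<in> cyclic_code n g"
    then obtain q where x: "length x = n" "set x \<subseteq> GF3" and q: "over_GF3 q" "Poly x = g * q"
      by (auto simp: cyclic_code_def)
    define d where "d = map (coeff q) [0..<k]"
    have "\<forall>i\<ge>n. coeff (g * q) i = 0" using x by (simp add: nth_default_def flip: q(2))
    hence "Poly d = q" unfolding d_def k_def
      using coeff_mult_eq_0_beyond_iff[OF g(2) deg] by (intro Poly_map_coeff) blast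
    hence "enc d = x" using map_coeff_Poly[of x] x(1) by (simp add: enc_def flip: q(2))
    moreover have "d \<in> L" using q(1) by (auto simp: d_def L_def over_GF3_def)
    ultimately show "x \<in> enc ` L" by blast
  qed
  ultimately have "card (cyclic_code n g) = card L" by (metis card_image)
  also have "\<dots> = 3 ^ k"
    using card_lists_length_eq[of "GF3 :: 'a set" k] card_GF3[OF c]
    by (simp add: L_def card_ge_0_finite)
  finally show ?thesis by (simp add: k_def)
qed

lemma poly_Poly_eq_sum:
  fixes x :: "'a::comm_ring_1"
  shows "poly (Poly c) x = (\<Sum>i<length c. c ! i * x ^ i)"
  by (induction c) (simp_all add: sum.lessThan_Suc_shift sum_distrib_left mult_ac del: sum.lessThan_Suc)

text \<open>Exponents reduce modulo the order of the multiplicative group, which gives surjectivity;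
  injectivity follows by counting.\<close>

lemma generator_bij_betw:
  fixes \<alpha> :: "'a::{finite,field}"
  assumes "\<alpha> \<noteq> 0" and "\<forall>x::'a. x \<noteq> 0 \<longrightarrow> (\<exists>i. x = \<alpha> ^ i)"
  shows "bij_betw (\<lambda>i. \<alpha> ^ i) {..<card (UNIV :: 'a set) - 1} (UNIV - {0})"
proof -
  define n where "n = card (UNIV :: 'a set) - 1"
  have "card {0, 1 :: 'a} \<le> card (UNIV :: 'a set)" by (rule card_mono) auto
  hence n: "n > 0" "card (UNIV :: 'a set) = Suc n" by (auto simp: n_def)
  have one: "\<alpha> ^ n = 1" using finite_field_power_card[of \<alpha>] assms(1) by (simp add: n(2))
  have "\<alpha> ^ i = \<alpha> ^ (i mod n)" for i
  proof -
    have "\<alpha> ^ (n * (i div n) + i mod n) = \<alpha> ^ (i mod n)"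
      by (simp only: power_add power_mult one power_one mult_1)
    thus ?thesis by simp
  qed
  hence "(\<lambda>i. \<alpha> ^ i) ` {..<n} = UNIV - {0}"
    using assms n(1) by auto (metis imageI lessThan_iff mod_less_divisor)
  moreover from this have "inj_on (\<lambda>i. \<alpha> ^ i) {..<n}"
    by (intro eq_card_imp_inj_on) (simp_all add: card_Diff_singleton n_def)
  ultimately show ?thesis by (simp add: bij_betw_def n_def)
qed

text \<open>Disjoint orbits make the product squarefree: it is the product of linear factors over
  the union, and a polynomial over the prime field vanishes on a whole orbit once it does at one
  point.\<close>

lemma minpoly3_mult_dvd_iff:
  fixes a b :: "'a::{finite,field}"
  assumes c: "CHAR('a) = 3" and disj: "conjugates3 a \<inter> conjugates3 b = {}" and p: "over_GF3 p"
  shows "minpoly3 a * minpoly3 b dvd p \<longleftrightarrow> poly p a = 0 \<and> poly p b = 0"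
proof
  assume "minpoly3 a * minpoly3 b dvd p"
  thus "poly p a = 0 \<and> poly p b = 0" using poly_minpoly3_self[OF c] by auto
next
  assume root: "poly p a = 0 \<and> poly p b = 0"
  have "minpoly3 a * minpoly3 b = (\<Prod>s\<in>conjugates3 a \<union> conjugates3 b. [:-s, 1:])"
    by (simp only: minpoly3_eq[OF c] prod.union_disjoint[OF finite finite disj])
  also have "\<dots> dvd p"
    using over_GF3_root_power[OF c p] root by (intro prod_linear_dvd) (auto simp: conjugates3_def)
  finally show "minpoly3 a * minpoly3 b dvd p" .
qed

lemma mem_code_1e_iff:
  fixes \<alpha> :: "'a::{finite,field}"
  assumes c: "CHAR('a) = 3" and disj: "conjugates3 \<alpha> \<inter> conjugates3 (\<alpha> ^ e) = {}"
  shows "w \<in> code_1e n \<alpha> e \<longleftrightarrow>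
    length w = n \<and> set w \<subseteq> GF3 \<and> poly (Poly w) \<alpha> = 0 \<and> poly (Poly w) (\<alpha> ^ e) = 0"
proof -
  define g where "g = minpoly3 \<alpha> * minpoly3 (\<alpha> ^ e)"
  have g: "over_GF3 g"
    unfolding g_def by (intro over_GF3_mult over_GF3_minpoly3 c)
  have "minpoly3 b \<noteq> 0" for b :: 'a
    using monic_minpoly3[OF c, of b] by (metis coeff_0 zero_neq_one)
  hence g0: "g \<noteq> 0" by (simp add: g_def)
  have "(\<exists>q. over_GF3 q \<and> Poly w = g * q) \<longleftrightarrow> g dvd Poly w" if "set w \<subseteq> GF3"
    using over_GF3_Poly[OF that] over_GF3_mult_cancel[OF c g _ g0] by (metis dvd_def)
  thus ?thesis
    using minpoly3_mult_dvd_iff[OF c disj] over_GF3_Poly[of w]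
    unfolding code_1e_def cyclic_code_def g_def[symmetric] by blast
qed

text \<open>Codewords are viewed as functions on the field, the coordinate \<open>i\<close> being
  attached to \<open>\<alpha>\<^sup>i\<close>; the value at \<open>0\<close> is normalised to \<open>0\<close>.\<close>

definition word_of :: "'a::field \<Rightarrow> nat \<Rightarrow> ('a \<Rightarrow> 'a) \<Rightarrow> 'a list" where
  "word_of \<alpha> n F = map (\<lambda>i. F (\<alpha> ^ i)) [0..<n]"

definition parity_check :: "nat \<Rightarrow> ('a::field \<Rightarrow> 'a) \<Rightarrow> bool" where
  "parity_check e F \<longleftrightarrow> range F \<subseteq> GF3 \<and> F 0 = 0 \<and>
     (\<Sum>x\<in>UNIV. F x * x) = 0 \<and> (\<Sum>x\<in>UNIV. F x * x ^ e) = 0"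

section \<open>Codewords for a fixed generator of the multiplicative group\<close>

locale ternary_generator =
  fixes \<alpha> :: "'a::{finite,field}" and m n :: nat
  assumes card: "card (UNIV :: 'a set) = 3 ^ m" and m2: "m \<ge> 2"
    and nonzero: "\<alpha> \<noteq> 0" and gen: "\<forall>x::'a. x \<noteq> 0 \<longrightarrow> (\<exists>i. x = \<alpha> ^ i)"
    and n_eq: "n = 3 ^ m - 1"
begin

lemma char3: "CHAR('a) = 3"
  by (rule CHAR_three[OF card])

lemma bij: "bij_betw (\<lambda>i. \<alpha> ^ i) {..<n} (UNIV - {0})"
  using generator_bij_betw[OF nonzero gen] by (simp add: card n_eq)

lemma power_eq_iff: "i < n \<Longrightarrow> j < n \<Longrightarrow> \<alpha> ^ i = \<alpha> ^ j \<longleftrightarrow> i = j"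
  using bij unfolding bij_betw_def inj_on_def by auto

text \<open>Keeps exponents in the range where \<open>power_eq_iff\<close> applies. The factor
  \<open>2\<close> serves the comparison of squares of conjugates in
  \<open>planar_imp_card_conjugates3\<close>.\<close>

lemma three_power_bound:
  assumes "i < m"
  shows "2 * 3 ^ i < n"
proof -
  obtain b :: nat where b: "b = 3 ^ (m - 1)" by blast
  have "(3::nat) ^ i \<le> b" unfolding b using assms by (intro power_increasing) auto
  moreover have "(3::nat) ^ m = 3 * b" unfolding b using m2 by (cases m) auto
  moreover have "(3::nat) ^ 1 \<le> b" unfolding b using m2 by (intro power_increasing) auto
  ultimately show ?thesis by (simp add: n_eq)
qed

lemma card_conjugates3_generator: "card (conjugates3 \<alpha>) = m"
proof -
  have "inj_on (\<lambda>i. \<alpha> ^ (3 ^ i)) {..<m}"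
  proof (rule inj_onI)
    fix i j assume ij: "i \<in> {..<m}" "j \<in> {..<m}" "\<alpha> ^ (3 ^ i) = \<alpha> ^ (3 ^ j)"
    have "3 ^ i < n" "3 ^ j < n" using three_power_bound[of i] three_power_bound[of j] ij by auto
    thus "i = j" using ij(3) power_eq_iff[of "3 ^ i" "3 ^ j"] by simp
  qed
  thus ?thesis using m2 by (simp add: conjugates3_eq[OF card] card_image)
qed

text \<open>A common conjugate makes \<alpha>\<open>^ e\<close> itself a conjugate of \<alpha>; both
  exponents lie below \<open>n\<close>, so \<open>e\<close> would be a power of
  \<open>3\<close>.\<close>

lemma conjugates3_disjoint:
  assumes "e < n" and "\<And>k. e \<noteq> 3 ^ k"
  shows "conjugates3 \<alpha> \<inter> conjugates3 (\<alpha> ^ e) = {}"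
proof (rule ccontr)
  assume "\<not> ?thesis"
  then obtain i j where eq: "\<alpha> ^ (3 ^ i) = (\<alpha> ^ e) ^ (3 ^ j)" and j: "j < m"
    using m2 conjugates3_eq[OF card, of "\<alpha> ^ e"] by (auto simp: conjugates3_def)
  \<comment> \<open>The extra \<open>m - j\<close> cubings complete a full Frobenius cycle on the
    left.\<close>
  have "(\<alpha> ^ e) ^ (3 ^ j * 3 ^ (m - j)) = \<alpha> ^ (3 ^ i * 3 ^ (m - j))"
    using eq by (simp add: power_mult)
  moreover have "(3::nat) ^ j * 3 ^ (m - j) = 3 ^ m" using j by (simp add: power_add[symmetric])
  ultimately have "\<alpha> ^ e = \<alpha> ^ (3 ^ (i + (m - j)))"
    using finite_field_power_card[of "\<alpha> ^ e"] card by (simp add: power_add)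
  then have "\<alpha> ^ e \<in> conjugates3 \<alpha>" by (auto simp: conjugates3_def)
  then obtain k where "k < m" "\<alpha> ^ e = \<alpha> ^ (3 ^ k)" using m2 by (auto simp: conjugates3_eq[OF card])
  thus False using assms three_power_bound[of k] by (simp add: power_eq_iff)
qed

lemma word_of_surj:
  assumes "length w = n"
  obtains F where "F 0 = 0" "w = word_of \<alpha> n F"
proof -
  define F where "F = (\<lambda>x. if x = 0 then 0 else w ! the_inv_into {..<n} (\<lambda>i. \<alpha> ^ i) x)"
  have inv: "the_inv_into {..<n} (\<lambda>i. \<alpha> ^ i) (\<alpha> ^ i) = i" if "i < n" for i
    using bij that by (intro the_inv_into_f_f) (auto simp: bij_betw_def)
  have "w = word_of \<alpha> n F"
    by (rule nth_equalityI) (simp_all add: word_of_def assms F_def nonzero inv)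
  thus thesis by (intro that[of F]) (simp_all add: F_def)
qed

lemma poly_word_of:
  assumes "F 0 = 0"
  shows "poly (Poly (word_of \<alpha> n F)) (\<alpha> ^ k) = (\<Sum>x\<in>UNIV. F x * x ^ k)"
proof -
  have "poly (Poly (word_of \<alpha> n F)) (\<alpha> ^ k) = (\<Sum>i<n. F (\<alpha> ^ i) * (\<alpha> ^ i) ^ k)"
    by (simp add: poly_Poly_eq_sum word_of_def power_mult[symmetric] mult.commute)
  also have "\<dots> = (\<Sum>x\<in>UNIV - {0}. F x * x ^ k)"
    by (rule sum.reindex_bij_betw[OF bij])
  also have "\<dots> = (\<Sum>x\<in>UNIV. F x * x ^ k)"
    by (rule sum.mono_neutral_left) (simp_all add: assms)
  finally show ?thesis .
qed

lemma set_word_of: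
  assumes "F 0 = 0"
  shows "insert 0 (set (word_of \<alpha> n F)) = range F"
proof -
  have "set (word_of \<alpha> n F) = F ` ((\<lambda>i. \<alpha> ^ i) ` {..<n})"
    by (auto simp: word_of_def)
  also have "(\<lambda>i. \<alpha> ^ i) ` {..<n} = UNIV - {0}" using bij by (simp add: bij_betw_def)
  finally show ?thesis using assms by (metis image_insert insert_Diff UNIV_I)
qed

lemma hweight_word_of:
  assumes "F 0 = 0"
  shows "hweight (word_of \<alpha> n F) = card {x. F x \<noteq> 0}"
proof -
  have "hweight (word_of \<alpha> n F) = card {i \<in> {..<n}. F (\<alpha> ^ i) \<noteq> 0}"
    unfolding hweight_def word_of_def length_filter_conv_card
    by (rule arg_cong[where f=card]) auto
  also have "\<dots> = card ((\<lambda>i. \<alpha> ^ i) ` {i \<in> {..<n}. F (\<alpha> ^ i) \<noteq> 0})"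
    by (rule card_image[symmetric]) (use bij in \<open>auto simp: bij_betw_def inj_on_def\<close>)
  also have "(\<lambda>i. \<alpha> ^ i) ` {i \<in> {..<n}. F (\<alpha> ^ i) \<noteq> 0} = {x. F x \<noteq> 0}"
  proof -
    have "x \<in> (\<lambda>i. \<alpha> ^ i) ` {..<n}" if "F x \<noteq> 0" for x
      using bij that assms by (auto simp: bij_betw_def)
    thus ?thesis by auto
  qed
  finally show ?thesis .
qed

lemma code_1e_eq:
  assumes "conjugates3 \<alpha> \<inter> conjugates3 (\<alpha> ^ e) = {}"
  shows "code_1e n \<alpha> e = word_of \<alpha> n ` {F. parity_check e F}"
proof -
  have zero: "(0 :: 'a) \<in> GF3" by (simp add: GF3_eq[OF char3])
  have mem: "word_of \<alpha> n F \<in> code_1e n \<alpha> e \<longleftrightarrow> parity_check e F" if "F 0 = 0" for F :: "'a \<Rightarrow> 'a"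
  proof -
    have "set (word_of \<alpha> n F) \<subseteq> GF3 \<longleftrightarrow> range F \<subseteq> GF3"
      unfolding set_word_of[of F, OF that, symmetric] using zero by simp
    moreover have "poly (Poly (word_of \<alpha> n F)) \<alpha> = (\<Sum>x\<in>UNIV. F x * x)"
      using poly_word_of[of F, OF that, of 1] by (simp only: power_one_right)
    moreover have "length (word_of \<alpha> n F) = n" by (simp add: word_of_def)
    ultimately show ?thesis
      unfolding mem_code_1e_iff[OF char3 assms] parity_check_def poly_word_of[of F, OF that]
      using that by simp
  qed
  show ?thesis
  proof (intro equalityI subsetI)
    fix w assume w: "w \<in> code_1e n \<alpha> e"
    hence "length w = n" by (simp add: code_1e_def cyclic_code_def)
    then obtain F where "F 0 = 0" "w = word_of \<alpha> n F" by (rule word_of_surj)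
    thus "w \<in> word_of \<alpha> n ` {F. parity_check e F}" using mem w by blast
  next
    fix w assume "w \<in> word_of \<alpha> n ` {F. parity_check e F}"
    thus "w \<in> code_1e n \<alpha> e" using mem by (auto simp: parity_check_def)
  qed
qed

lemma min_dist_code_1e:
  assumes "conjugates3 \<alpha> \<inter> conjugates3 (\<alpha> ^ e) = {}"
  shows "min_dist (code_1e n \<alpha> e) = Min ((\<lambda>F. card {x. F x \<noteq> 0}) `
      {F :: 'a \<Rightarrow> 'a. parity_check e F \<and> (\<exists>x. F x \<noteq> 0)})"
proof -
  have weight_zero: "w = replicate (length w) 0 \<longleftrightarrow> hweight w = 0" for w :: "'a list"
  proof -
    have "w = replicate (length w) 0 \<longleftrightarrow> (\<forall>x\<in>set w. x = 0)"
      by (metis in_set_replicate replicate_length_same)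
    thus ?thesis by (simp add: hweight_def filter_empty_conv)
  qed
  have hw: "hweight (word_of \<alpha> n F) = card {x. F x \<noteq> 0}" if "parity_check e F" for F
    by (rule hweight_word_of) (use that in \<open>simp add: parity_check_def\<close>)
  have "{hweight c | c. c \<in> code_1e n \<alpha> e \<and> c \<noteq> replicate (length c) 0}
      = hweight ` {c \<in> word_of \<alpha> n ` {F. parity_check e F}. hweight c \<noteq> 0}"
    unfolding code_1e_eq[OF assms] weight_zero by blast
  also have "\<dots> = (\<lambda>F. hweight (word_of \<alpha> n F)) `
      {F. parity_check e F \<and> hweight (word_of \<alpha> n F) \<noteq> 0}"
    by blast
  also have "\<dots> = (\<lambda>F. card {x. F x \<noteq> 0}) `
      {F :: 'a \<Rightarrow> 'a. parity_check e F \<and> card {x. F x \<noteq> 0} \<noteq> 0}"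
    by (intro image_cong) (auto simp: hw card_gt_0_iff)
  also have "\<dots> = (\<lambda>F. card {x. F x \<noteq> 0}) `
      {F :: 'a \<Rightarrow> 'a. parity_check e F \<and> (\<exists>x. F x \<noteq> 0)}"
    by simp
  finally show ?thesis by (simp add: min_dist_def)
qed

lemma min_dist_code_1e_le:
  fixes F :: "'a \<Rightarrow> 'a"
  assumes "conjugates3 \<alpha> \<inter> conjugates3 (\<alpha> ^ e) = {}"
    and "parity_check e F" and "F x \<noteq> 0" and "{x. F x \<noteq> 0} \<subseteq> T"
  shows "min_dist (code_1e n \<alpha> e) \<le> card T"
proof -
  have "min_dist (code_1e n \<alpha> e) \<le> card {x. F x \<noteq> 0}"
    unfolding min_dist_code_1e[OF assms(1)] using assms(2,3) by (intro Min_le) auto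
  also have "\<dots> \<le> card T" using assms(4) by (intro card_mono) auto
  finally show ?thesis .
qed

text \<open>The nonzero word \<open>F\<close> ensures that \<open>Min\<close> is taken over a
  nonempty set.\<close>

lemma min_dist_code_1e_ge:
  fixes F :: "'a \<Rightarrow> 'a"
  assumes "conjugates3 \<alpha> \<inter> conjugates3 (\<alpha> ^ e) = {}"
    and "parity_check e F" and "F x \<noteq> 0"
    and "\<And>(G :: 'a \<Rightarrow> 'a) y. parity_check e G \<Longrightarrow> G y \<noteq> 0 \<Longrightarrow> d \<le> card {x. G x \<noteq> 0}"
  shows "d \<le> min_dist (code_1e n \<alpha> e)"
  unfolding min_dist_code_1e[OF assms(1)]
proof (rule Min.boundedI)
  show "(\<lambda>F. card {x. F x \<noteq> 0}) ` {F :: 'a \<Rightarrow> 'a. parity_check e F \<and> (\<exists>x. F x \<noteq> 0)} \<noteq> {}"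
    using assms(2,3) by blast
  show "d \<le> k" if "k \<in> (\<lambda>F. card {x. F x \<noteq> 0}) `
      {F :: 'a \<Rightarrow> 'a. parity_check e F \<and> (\<exists>x. F x \<noteq> 0)}" for k
    using that assms(4) by blast
qed simp

end

section \<open>Planarity and short codewords\<close>

lemma planar_diff_inj:
  fixes f :: "'a::{finite,field} \<Rightarrow> 'a"
  assumes "planar f" "a \<noteq> 0" "f (x + a) - f x = f (y + a) - f y"
  shows "x = y"
proof -
  have "card {z. f (z + a) - f z = f (y + a) - f y} \<le> Suc 0"
    using assms(1,2) unfolding planar_def One_nat_def by blast
  thus ?thesis using assms(3) unfolding card_le_Suc0_iff_eq[OF finite] by blast
qed

text \<open>The shift \<open>y - x\<close> takes \<open>x\<close> to \<open>y\<close> and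
  \<open>- y\<close> to \<open>- x\<close>; both differences of values vanish, so planarity
  identifies \<open>x\<close> with \<open>- y\<close>.\<close>

lemma planar_even_eq:
  fixes f :: "'a::{finite,field} \<Rightarrow> 'a"
  assumes "planar f" "\<And>x. f (- x) = f x" "f x = f y"
  shows "x = y \<or> x = - y"
proof (cases "x = y")
  case False
  hence "y - x \<noteq> 0" by simp
  moreover have "f (x + (y - x)) - f x = f (- y + (y - x)) - f (- y)"
    by (simp add: assms(2,3))
  ultimately show ?thesis using planar_diff_inj[OF assms(1)] by blast
qed simp

text \<open>In characteristic three, sum zero means that \<open>x\<close>, \<open>y\<close>,
  \<open>z\<close> is an arithmetic progression. Sum zero of the values then says that the two
  successive differences of \<open>f\<close> agree.\<close>

lemma planar_sum_three:
  fixes f :: "'a::{finite,field} \<Rightarrow> 'a"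
  assumes c: "CHAR('a) = 3" and f: "planar f" and "x + y + z = 0" "f x + f y + f z = 0"
  shows "x = y"
proof (rule ccontr)
  assume "x \<noteq> y"
  hence d: "y - x \<noteq> 0" by simp
  note three = three_eq_0[OF c]
  have z: "y + (y - x) = z"
  proof -
    have "y + (y - x) - z = 3 * y - (x + y + z)" by simp
    thus ?thesis using assms(3) three by simp
  qed
  have "(f (y + (y - x)) - f y) - (f (x + (y - x)) - f x) = (f x + f y + f z) - 3 * f y"
    unfolding z by simp
  also have "\<dots> = 0" by (simp only: assms(4) three mult_zero_left diff_self)
  finally have "f (y + (y - x)) - f y = f (x + (y - x)) - f x" by (simp only: right_minus_eq)
  thus False using planar_diff_inj[OF f d] \<open>x \<noteq> y\<close> by blast
qed

text \<open>The shift by \<open>y\<close> produces the same difference at \<open>x\<close> as at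
  \<open>0\<close>.\<close>

lemma planar_additive:
  fixes f :: "'a::{finite,field} \<Rightarrow> 'a"
  assumes f: "planar f" "f 0 = 0" and "f (x + y) = f x + f y"
  shows "x = 0 \<or> y = 0"
proof (rule ccontr)
  assume "\<not> ?thesis"
  moreover have "f (x + y) - f x = f (0 + y) - f 0" using assms(2,3) by simp
  ultimately show False using planar_diff_inj[OF f(1), of y x 0] by blast
qed

lemma planar_diff_surj:
  fixes f :: "'a::{finite,field} \<Rightarrow> 'a"
  assumes "planar f" "a \<noteq> 0"
  obtains x where "f (x + a) - f x = b"
proof -
  have "inj (\<lambda>x. f (x + a) - f x)"
    using planar_diff_inj[OF assms] by (rule injI)
  hence "surj (\<lambda>x. f (x + a) - f x)" by (rule finite_UNIV_inj_surj[OF finite])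
  then obtain x where "b = f (x + a) - f x" by (rule surjE)
  thus thesis using that by simp
qed

text \<open>All nonzero entries are signs, so a support of size at most three leaves few relations.
  Size two forces \<open>x = y\<close> or, with equal signs, \<open>y = - x\<close>, which evenness
  of \<open>e\<close> excludes. Size three is handled by \<open>planar_sum_three\<close> and
  \<open>planar_additive\<close>.\<close>

lemma parity_check_weight_ge_4:
  fixes F :: "'a::{finite,field} \<Rightarrow> 'a"
  assumes c: "CHAR('a) = 3" and f: "planar (\<lambda>x::'a. x ^ e)" and e: "even e" "e > 0"
    and F: "parity_check e F" and nz: "F u \<noteq> 0"
  shows "4 \<le> card {x. F x \<noteq> 0}"
proof (rule ccontr)
  assume small: "\<not> ?thesis"
  define S where "S = {x. F x \<noteq> 0}"
  have F0: "F 0 = 0" using F by (simp add: parity_check_def)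
  have val: "F x = 1 \<or> F x = -1" if "x \<in> S" for x
  proof -
    have "F x \<in> GF3" using F by (auto simp: parity_check_def)
    thus ?thesis using that by (auto simp: S_def GF3_eq[OF c])
  qed
  have S0: "x \<noteq> 0" if "x \<in> S" for x using that F0 by (auto simp: S_def)
  have sum1: "(\<Sum>x\<in>S. F x * x) = 0" and sume: "(\<Sum>x\<in>S. F x * x ^ e) = 0"
    using F unfolding parity_check_def S_def
    by (simp_all add: sum.mono_neutral_left[of UNIV "{x. F x \<noteq> 0}"])
  have "card S \<noteq> 0" using nz by (auto simp: S_def)
  then consider "card S = 1" | "card S = 2" | "card S = 3"
    using small unfolding S_def[symmetric] by linarith
  thus False
  proof cases
    case 1
    then obtain x where S: "S = {x}" by (rule card_1_singletonE)
    have "x \<in> S" by (simp add: S)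
    hence "F x * x \<noteq> 0" using val[of x] S0[of x] by auto
    thus False using sum1 unfolding S by simp
  next
    case 2
    then obtain x y where S: "S = {x, y}" "x \<noteq> y" by (auto simp: card_2_iff)
    have eq: "F x * x + F y * y = 0" "F x * x ^ e + F y * y ^ e = 0"
      using sum1 sume S by simp_all
    consider "F x = F y" | "F x = - F y" using val[of x] val[of y] S by auto
    thus False
    proof cases
      case 1
      have "F y \<noteq> 0" using S by (auto simp: S_def)
      hence "x + y = 0" "x ^ e + y ^ e = 0"
        using eq unfolding 1 by (simp_all add: distrib_left[symmetric])
      hence "y = - x" by (simp add: add_eq_0_iff)
      hence "2 * x ^ e = 0" using \<open>x ^ e + y ^ e = 0\<close> e(1) by simp
      thus False using S0[of x] S two_eq_minus_1[OF c] by simp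
    next
      case 2
      have "F y \<noteq> 0" using S by (auto simp: S_def)
      hence "x = y" using eq(1) unfolding 2 by (simp add: algebra_simps)
      thus False using S(2) by simp
    qed
  next
    case 3
    then obtain x y z where S: "S = {x, y, z}" "x \<noteq> y" "y \<noteq> z" "x \<noteq> z"
      by (auto simp: card_3_iff)
    have eq1: "F x * x + F y * y + F z * z = 0"
      and eqe: "F x * x ^ e + F y * y ^ e + F z * z ^ e = 0"
      using sum1 sume S by (simp_all add: add.assoc)
    have xyz: "x \<noteq> 0" "y \<noteq> 0" "z \<noteq> 0" using S0 S by auto
    have add: False if "a = b + d" "a ^ e = b ^ e + d ^ e" "b \<noteq> 0" "d \<noteq> 0" for a b d :: 'a
      using planar_additive[OF f _, of b d] that e by (auto simp: zero_power)
    have nosum: "\<not> (x + y + z = 0 \<and> x ^ e + y ^ e + z ^ e = 0)"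
      using planar_sum_three[OF c f, of x y z] S(2) by blast
    have cancel: "F w \<noteq> 0" if "w \<in> S" for w using that by (simp add: S_def)
    \<comment> \<open>Up to a global sign: either all signs agree, or one point is the sum of the
      other two and so are the \<open>e\<close>-th powers.\<close>
    consider "F x = F y" "F z = F y" | "F x = F y" "F z = - F y"
      | "F x = - F y" "F z = F y" | "F x = - F y" "F z = - F y"
      using val[of x] val[of y] val[of z] S by auto
    thus False
    proof cases
      case 1
      have "F y * (x + y + z) = 0" "F y * (x ^ e + y ^ e + z ^ e) = 0"
        using eq1 eqe unfolding 1 by (simp_all add: algebra_simps)
      thus False using nosum cancel[of y] S by simp
    next
      case 2
      have "F y * (x + y - z) = 0" "F y * (x ^ e + y ^ e - z ^ e) = 0"
        using eq1 eqe unfolding 2 by (simp_all add: algebra_simps)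
      hence "z = x + y" "z ^ e = x ^ e + y ^ e" using cancel[of y] S by simp_all
      thus False using add xyz by blast
    next
      case 3
      have "F y * (x - (y + z)) = 0" "F y * (x ^ e - (y ^ e + z ^ e)) = 0"
        using eq1 eqe unfolding 3 by (simp_all add: algebra_simps)
      hence "x = y + z" "x ^ e = y ^ e + z ^ e" using cancel[of y] S by simp_all
      thus False using add xyz by blast
    next
      case 4
      have "F y * (y - (x + z)) = 0" "F y * (y ^ e - (x ^ e + z ^ e)) = 0"
        using eq1 eqe unfolding 4 by (simp_all add: algebra_simps)
      hence "y = x + z" "y ^ e = x ^ e + z ^ e" using cancel[of y] S by simp_all
      thus False using add xyz by blast
    qed
  qed
qed

text \<open>The indicator of \<open>a\<close>, except that the point \<open>0\<close> gives the zero
  function. Combinations thus vanish at \<open>0\<close> even when a chosen position happens to be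
  \<open>0\<close>.\<close>

definition point :: "'a::zero_neq_one \<Rightarrow> 'a \<Rightarrow> 'a" where
  "point a x = (if x = a \<and> x \<noteq> 0 then 1 else 0)"

lemma sum_point_mult:
  fixes g :: "'a::{finite,field} \<Rightarrow> 'a"
  assumes "g 0 = 0"
  shows "(\<Sum>x\<in>UNIV. point a x * g x) = g a"
proof -
  have "point a x * g x = (if x = a then g x else 0)" for x
    using assms by (simp add: point_def)
  thus ?thesis by simp
qed

lemma GF3_closed:
  fixes x y :: "'a::field"
  assumes "CHAR('a) = 3" "x \<in> GF3" "y \<in> GF3"
  shows "x + y \<in> GF3" "x - y \<in> GF3"
proof -
  have "x ^ 3 = x" "y ^ 3 = y" using assms GF3_iff[OF assms(1)] by blast+
  thus "x + y \<in> GF3" "x - y \<in> GF3"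
    using add_power_3[OF assms(1), of x y 1] diff_power_3[OF assms(1), of x y 1]
    unfolding GF3_iff[OF assms(1)] power_one_right by simp_all
qed

lemma point_in_GF3: "point a x \<in> (GF3 :: 'a::field set)"
proof -
  have "of_nat 0 \<in> (GF3 :: 'a set)" "of_nat 1 \<in> (GF3 :: 'a set)" unfolding GF3_def by blast+
  thus ?thesis by (simp add: point_def)
qed

section \<open>Arithmetic of the exponent\<close>

lemma even_exponent_iff:
  assumes "e = (3 ^ h + 1) div (2::nat)"
  shows "even e \<longleftrightarrow> odd h"
proof (cases "odd h")
  case True
  thus ?thesis using three_power_odd_mod_4[of h] assms by presburger
next
  case False
  then obtain j where "h = 2 * j" by (auto elim: evenE)
  moreover have "(9::nat) ^ j mod 4 = 1" by (induction j) (auto simp: mod_mult_right_eq[symmetric])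
  ultimately have "(3::nat) ^ h mod 4 = 1" by (simp add: power_mult)
  thus ?thesis using False assms by presburger
qed

text \<open>Otherwise \<open>3 ^ h + 1 = 2 * 3 ^ k\<close>, which fails modulo \<open>3\<close> for
  positive \<open>k\<close> and by size for \<open>k = 0\<close>.\<close>

lemma exponent_not_power_3:
  assumes "e = (3 ^ h + 1) div (2::nat)" "h \<ge> 1"
  shows "e \<noteq> 3 ^ k"
proof
  assume "e = 3 ^ k"
  moreover have "odd ((3::nat) ^ h)" by simp
  ultimately have eq: "(3::nat) ^ h + 1 = 2 * 3 ^ k" using assms(1) by presburger
  have "(3::nat) dvd 3 ^ h" using assms(2) by (simp add: dvd_power)
  show False
  proof (cases k)
    case 0
    thus False using eq assms(2) by simp
  next
    case (Suc j)
    hence "(3::nat) dvd 3 ^ h + 1" using eq by simp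
    thus False using \<open>(3::nat) dvd 3 ^ h\<close> dvd_add_right_iff[of 3 "3 ^ h" "1 :: nat"] by simp
  qed
qed

section \<open>Code parameters and planarity, case by case\<close>

context ternary_generator
begin

text \<open>The element \<open>t\<close> generates the multiplicative group of the subfield with
  \<open>3 ^ g\<close> elements, whose order is at least \<open>8\<close>. The condition on
  \<open>t ^ 4\<close> later keeps \<open>t + 1 / t\<close> and \<open>t - 1 / t\<close>
  nonzero.\<close>

lemma ex_large_order_subfield_element:
  assumes "g dvd m" "g dvd h" "g > 1"
  obtains t :: 'a where "t \<noteq> 0" "t ^ (3 ^ h) = t" "t ^ 4 \<noteq> 1"
proof -
  define x :: nat where "x = 3 ^ g - 1"
  have "(3::nat) ^ 2 \<le> 3 ^ g" using assms(3) by (intro power_increasing) auto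
  hence x8: "x \<ge> 8" and x: "3 ^ g = Suc x" by (auto simp: x_def)
  \<comment> \<open>This shows that \<open>3 ^ g - 1\<close> divides \<open>3 ^ m - 1\<close>; the
    cofactor \<open>l\<close> is the exponent defining \<open>t\<close>.\<close>
  have "\<exists>l. Suc x ^ k = x * l + 1" for k
  proof (induction k)
    case (Suc k)
    then obtain l where "Suc x ^ k = x * l + 1" by blast
    hence "Suc x ^ Suc k = x * (Suc x * l + 1) + 1" by (simp add: algebra_simps)
    thus ?case by blast
  qed simp
  moreover obtain k where "m = g * k" using assms(1) by blast
  ultimately obtain l where l: "3 ^ m = x * l + 1" by (metis power_mult x)
  hence n: "n = x * l" by (simp add: n_eq)
  have "n > 0" using three_power_bound[of 0] m2 by simp
  hence "l > 0" using n by (cases l) auto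
  define t where "t = \<alpha> ^ l"
  have "t ^ 3 ^ m = t" using finite_field_power_card[of t] by (simp add: card)
  have "\<alpha> ^ (Suc n) = \<alpha>" using finite_field_power_card[of \<alpha>] card l n by simp
  hence "\<alpha> ^ n = 1" using nonzero by simp
  hence "t ^ x = 1" by (simp add: t_def n power_mult[symmetric] mult.commute)
  hence tg: "t ^ (3 ^ g) = t" by (simp add: x)
  have "t ^ (3 ^ (g * j)) = t" for j
    by (induction j) (simp_all add: power_add power_mult tg)
  hence "t ^ (3 ^ h) = t" using assms(2) by auto
  moreover have "t ^ 4 \<noteq> 1"
  proof -
    have "4 * l < x * l" using x8 \<open>l > 0\<close> by simp
    hence "\<alpha> ^ (l * 4) \<noteq> \<alpha> ^ 0" using power_eq_iff[of "l * 4" 0] \<open>l > 0\<close> n by simp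
    thus ?thesis by (simp add: t_def power_mult)
  qed
  moreover have "t \<noteq> 0" by (simp add: t_def nonzero)
  ultimately show thesis using that by blast
qed

text \<open>On a subfield fixed by the \<open>3\<^sup>h\<close>-power map, \<open>x\<^sup>e\<close> is the identity on squares, and
  \<open>(t + 1/t)\<^sup>2 - (t - 1/t)\<^sup>2 = 4 = 1\<close> provides two consecutive squares.\<close>
lemma ex_consecutive_fixed:
  assumes e: "e = (3 ^ h + 1) div 2" and g: "gcd m h > 1"
  obtains r s :: 'a where "r = s + 1" "r \<noteq> 0" "s \<noteq> 0" "r ^ e = r" "s ^ e = s"
proof -
  obtain t :: 'a where t: "t \<noteq> 0" "t ^ (3 ^ h) = t" "t ^ 4 \<noteq> 1"
    using ex_large_order_subfield_element[of "gcd m h" h] g by auto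
  have "odd ((3::nat) ^ h)" by simp
  hence e2: "2 * e = 3 ^ h + 1" using e by presburger
  have sq: "(z ^ 2) ^ e = z ^ 2" if "z ^ (3 ^ h) = z" for z :: 'a
  proof -
    have "(z ^ 2) ^ e = z ^ (3 ^ h + 1)" by (simp only: power_mult[symmetric] e2)
    thus ?thesis using that by (simp add: power2_eq_square)
  qed
  define a b where "a = t + 1 / t" and "b = t - 1 / t"
  have "a ^ (3 ^ h) = a" "b ^ (3 ^ h) = b"
    using t(2) by (simp_all add: a_def b_def add_power_3[OF char3] diff_power_3[OF char3] power_divide)
  hence fixed: "(a ^ 2) ^ e = a ^ 2" "(b ^ 2) ^ e = b ^ 2" by (simp_all only: sq)
  have diff: "a ^ 2 = b ^ 2 + 1"
  proof -
    have "a ^ 2 - b ^ 2 = 3 + 1" using t(1) by (simp add: a_def b_def field_simps power2_eq_square)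
    thus ?thesis using three_eq_0[OF char3] by (simp add: algebra_simps)
  qed
  have "a * b * t ^ 2 = t ^ 4 - 1"
    using t(1) by (simp add: a_def b_def field_simps power2_eq_square power4_eq_xxxx)
  hence "a ^ 2 \<noteq> 0" "b ^ 2 \<noteq> 0" using t(3) by auto
  thus thesis by (rule that[OF diff _ _ fixed])
qed

lemma planar_imp_min_dist_eq_4:
  assumes f: "planar (\<lambda>x::'a. x ^ e)" and e: "even e" "e > 0"
    and disj: "conjugates3 \<alpha> \<inter> conjugates3 (\<alpha> ^ e) = {}"
  shows "min_dist (code_1e n \<alpha> e) = 4"
proof -
  let ?f = "\<lambda>x::'a. x ^ e"
  have "card {0, 1, -1 :: 'a} < card (UNIV :: 'a set)"
  proof -
    have "(3::nat) ^ 2 \<le> 3 ^ m" using m2 by (intro power_increasing) auto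
    thus ?thesis using card_GF3[OF char3] by (simp add: card GF3_eq[OF char3])
  qed
  hence "{0, 1, -1 :: 'a} \<noteq> UNIV" by (metis less_irrefl)
  \<comment> \<open>Excluding \<open>-1\<close> makes the shift \<open>1 + v\<close> nonzero;
    excluding \<open>0\<close> and \<open>1\<close> keeps the word built below nonzero at position
    \<open>1\<close>.\<close>
  then obtain v :: 'a where v: "v \<noteq> 0" "v \<noteq> 1" "v \<noteq> -1" by auto
  have "1 + v \<noteq> 0" using v(3) by (simp add: add_eq_0_iff)
  then obtain y where y: "?f (y + (1 + v)) - ?f y = 1 + ?f v"
    using planar_diff_surj[OF f] by metis
  define x where "x = y + (1 + v)"
  have x1: "x \<noteq> 1"
  proof
    assume "x = 1"
    hence "y = - v" by (simp add: x_def add.left_commute add_eq_0_iff)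
    hence "?f y = ?f v" using e(1) by simp
    hence "1 - ?f v = 1 + ?f v"
      using y[folded x_def] \<open>x = 1\<close> by (simp only: power_one)
    hence "2 * ?f v = 0" by (simp add: algebra_simps)
    thus False using v(1) two_eq_minus_1[OF char3] by simp
  qed
  have two: "(2::'a) \<noteq> 0" unfolding two_eq_minus_1[OF char3] by simp
  define F where "F = (\<lambda>z. point x z - point y z - point 1 z - point v z)"
  \<comment> \<open>Positions may coincide: \<open>y = 1\<close> is possible, and then the entry is
    \<open>-2\<close>, still nonzero.\<close>
  have F1: "F 1 \<noteq> 0"
    using x1 v(2) two by (auto simp: F_def point_def)
  have "(\<Sum>z\<in>UNIV. F z * z) = x - y - 1 - v"
    using sum_point_mult[of "\<lambda>z::'a. z"] by (simp add: F_def left_diff_distrib sum_subtractf)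
  moreover have "(\<Sum>z\<in>UNIV. F z * z ^ e) = x ^ e - y ^ e - 1 - v ^ e"
    using sum_point_mult[of ?f] e(2) by (simp add: F_def left_diff_distrib sum_subtractf)
  moreover have "range F \<subseteq> GF3"
    unfolding F_def by (auto intro!: GF3_closed(2)[OF char3] point_in_GF3)
  moreover have "F 0 = 0" by (simp add: F_def point_def)
  ultimately have F: "parity_check e F" using y by (simp add: parity_check_def x_def)
  have "min_dist (code_1e n \<alpha> e) \<le> card {x, y, 1, v}"
    by (rule min_dist_code_1e_le[OF disj F F1]) (auto simp: F_def point_def)
  also have "\<dots> \<le> 4" using card_length[of "[x, y, 1, v]"] by simp
  finally have "min_dist (code_1e n \<alpha> e) \<le> 4" .
  moreover have "4 \<le> min_dist (code_1e n \<alpha> e)"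
    by (rule min_dist_code_1e_ge[OF disj F F1]) (rule parity_check_weight_ge_4[OF char3 f e])
  ultimately show ?thesis by simp
qed

text \<open>By \<open>planar_even_eq\<close>, coinciding conjugates of \<alpha>\<open>^ e\<close>
  come from conjugates of \<alpha> equal up to sign; squaring removes the sign and the exponents
  stay below \<open>n\<close>.\<close>

lemma planar_imp_card_conjugates3:
  assumes f: "planar (\<lambda>x::'a. x ^ e)" and e: "even e"
  shows "card (conjugates3 (\<alpha> ^ e)) = m"
proof -
  have "inj_on (\<lambda>i. (\<alpha> ^ e) ^ (3 ^ i)) {..<m}"
  proof (rule inj_onI)
    fix i j assume ij: "i \<in> {..<m}" "j \<in> {..<m}" "(\<alpha> ^ e) ^ (3 ^ i) = (\<alpha> ^ e) ^ (3 ^ j)"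
    have "(\<alpha> ^ (3 ^ i)) ^ e = (\<alpha> ^ (3 ^ j)) ^ e"
      using ij(3) by (simp only: power_mult[symmetric] mult.commute)
    hence "\<alpha> ^ (3 ^ i) = \<alpha> ^ (3 ^ j) \<or> \<alpha> ^ (3 ^ i) = - (\<alpha> ^ (3 ^ j))"
      using planar_even_eq[OF f, of "\<alpha> ^ (3 ^ i)" "\<alpha> ^ (3 ^ j)"] e by simp
    hence "(\<alpha> ^ (3 ^ i)) ^ 2 = (\<alpha> ^ (3 ^ j)) ^ 2" by auto
    hence "\<alpha> ^ (2 * 3 ^ i) = \<alpha> ^ (2 * 3 ^ j)" by (simp only: power_mult[symmetric] mult.commute)
    thus "i = j"
      using ij three_power_bound[of i] three_power_bound[of j]
        power_eq_iff[of "2 * 3 ^ i" "2 * 3 ^ j"] by simp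
  qed
  thus ?thesis using m2 by (simp add: conjugates3_eq[OF card] card_image)
qed

text \<open>Both minimal polynomials have degree \<open>m\<close>, so the generator polynomial has
  degree \<open>2 * m\<close>, which gives the dimension.\<close>

lemma planar_imp_params:
  assumes f: "planar (\<lambda>x::'a. x ^ e)" and e: "even e" "e > 0"
    and disj: "conjugates3 \<alpha> \<inter> conjugates3 (\<alpha> ^ e) = {}"
  shows "has_params3 (code_1e n \<alpha> e) n (n - 2 * m) 4"
proof -
  define g where "g = minpoly3 \<alpha> * minpoly3 (\<alpha> ^ e)"
  have nz: "minpoly3 b \<noteq> 0" for b :: 'a
    using monic_minpoly3[OF char3, of b] by (metis coeff_0 zero_neq_one)
  have deg: "degree g = 2 * m"
    using nz by (simp add: g_def degree_mult_eq degree_minpoly3[OF char3]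
        card_conjugates3_generator planar_imp_card_conjugates3[OF f e(1)])
  have "2 * m \<le> n"
  proof -
    have "m - 1 < 3 ^ (m - 1)" by (rule less_exp[THEN order_less_le_trans]) (intro power_mono, auto)
    thus ?thesis using three_power_bound[of "m - 1"] m2 by linarith
  qed
  moreover have "over_GF3 g"
    unfolding g_def by (intro over_GF3_mult over_GF3_minpoly3 char3)
  ultimately have "card (cyclic_code n g) = 3 ^ (n - 2 * m)"
    using card_cyclic_code[OF char3, of g n] nz deg by (simp add: g_def)
  moreover have "\<forall>c\<in>code_1e n \<alpha> e. length c = n" by (simp add: code_1e_def cyclic_code_def)
  ultimately show ?thesis
    using planar_imp_min_dist_eq_4[OF assms] by (simp add: has_params3_def code_1e_def g_def)
qed

lemma odd_exponent:
  assumes e: "odd e" and disj: "conjugates3 \<alpha> \<inter> conjugates3 (\<alpha> ^ e) = {}"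
  shows "\<not> planar (\<lambda>x::'a. x ^ e)" "min_dist (code_1e n \<alpha> e) \<le> 2"
proof -
  have e0: "e > 0" using e by (cases e) auto
  show "\<not> planar (\<lambda>x::'a. x ^ e)"
  proof
    assume "planar (\<lambda>x::'a. x ^ e)"
    \<comment> \<open>With shift \<open>1\<close>, both \<open>0\<close> and \<open>-1\<close> give
      the difference \<open>1\<close>.\<close>
    hence "(0::'a) = -1"
      by (rule planar_diff_inj[where a=1]) (use e e0 in \<open>auto simp: zero_power\<close>)
    thus False by simp
  qed
  define F :: "'a \<Rightarrow> 'a" where "F = (\<lambda>z. point 1 z + point (-1) z)"
  have "(1::'a) \<noteq> -1"
    using two_eq_minus_1[OF char3] by (metis add_cancel_left_left one_add_one one_neq_zero)
  hence F1: "F 1 \<noteq> 0" by (auto simp: F_def point_def)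
  have "(\<Sum>z\<in>UNIV. F z * z) = 0"
    using sum_point_mult[of "\<lambda>z::'a. z"] by (simp add: F_def distrib_right sum.distrib)
  moreover have "(\<Sum>z\<in>UNIV. F z * z ^ e) = 0"
    using sum_point_mult[of "\<lambda>z::'a. z ^ e"] e e0 by (simp add: F_def distrib_right sum.distrib)
  moreover have "range F \<subseteq> GF3"
    unfolding F_def by (auto intro!: GF3_closed(1)[OF char3] point_in_GF3)
  moreover have "F 0 = 0" by (simp add: F_def point_def)
  ultimately have F: "parity_check e F" by (simp add: parity_check_def)
  have "min_dist (code_1e n \<alpha> e) \<le> card {1, -1 :: 'a}"
    by (rule min_dist_code_1e_le[OF disj F F1]) (auto simp: F_def point_def)
  also have "\<dots> \<le> 2" using card_length[of "[1, -1 :: 'a]"] by simp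
  finally show "min_dist (code_1e n \<alpha> e) \<le> 2" .
qed

lemma not_coprime_exponent:
  assumes e: "e = (3 ^ h + 1) div 2" and g: "gcd m h > 1"
    and disj: "conjugates3 \<alpha> \<inter> conjugates3 (\<alpha> ^ e) = {}"
  shows "\<not> planar (\<lambda>x::'a. x ^ e)" "min_dist (code_1e n \<alpha> e) \<le> 3"
proof -
  obtain r s where rs: "r = s + 1" "r \<noteq> 0" "s \<noteq> 0" "r ^ e = r" "s ^ e = (s :: 'a)"
    using ex_consecutive_fixed[OF e g] by blast
  have e0: "e > 0" using e by (simp add: div_greater_zero_iff Suc_le_eq)
  show "\<not> planar (\<lambda>x::'a. x ^ e)"
  proof
    assume "planar (\<lambda>x::'a. x ^ e)"
    \<comment> \<open>With shift \<open>1\<close>, both \<open>s\<close> and \<open>0\<close> give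
      the difference \<open>1\<close>.\<close>
    hence "s = 0"
      by (rule planar_diff_inj[where a=1]) (use rs e0 in \<open>auto simp: zero_power\<close>)
    thus False using rs by simp
  qed
  define F :: "'a \<Rightarrow> 'a" where "F = (\<lambda>z. point r z - point s z - point 1 z)"
  \<comment> \<open>Position \<open>r\<close> meets neither \<open>s\<close> nor \<open>1\<close>,
    the latter because \<open>s\<close> is nonzero; \<open>s = 1\<close> does no harm.\<close>
  have F1: "F r \<noteq> 0" using rs(1-3) by (auto simp: F_def point_def)
  have "(\<Sum>z\<in>UNIV. F z * z) = 0"
    using sum_point_mult[of "\<lambda>z::'a. z"] rs(1)
    by (simp add: F_def left_diff_distrib sum_subtractf)
  moreover have "(\<Sum>z\<in>UNIV. F z * z ^ e) = r ^ e - s ^ e - 1"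
    using sum_point_mult[of "\<lambda>z::'a. z ^ e"] e0
    by (simp add: F_def left_diff_distrib sum_subtractf)
  moreover have "r ^ e - s ^ e - 1 = 0" unfolding rs(4,5) by (simp add: rs(1))
  moreover have "range F \<subseteq> GF3"
    unfolding F_def by (auto intro!: GF3_closed(2)[OF char3] point_in_GF3)
  moreover have "F 0 = 0" by (simp add: F_def point_def)
  ultimately have F: "parity_check e F" by (simp add: parity_check_def)
  have "min_dist (code_1e n \<alpha> e) \<le> card {r, s, 1}"
    by (rule min_dist_code_1e_le[OF disj F F1]) (auto simp: F_def point_def)
  also have "\<dots> \<le> 3" using card_length[of "[r, s, 1]"] by simp
  finally show "min_dist (code_1e n \<alpha> e) \<le> 3" .
qed

end

text \<open>The arithmetic condition on \<open>h\<close> implies both other properties, and its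
  failure refutes both, so the two equivalences follow together.\<close>

theorem theorem3:
  fixes \<alpha> :: "'a::{finite,field}" and m h e :: nat
  assumes "card (UNIV :: 'a set) = 3 ^ m"
    and "m \<ge> 2"
    and "\<alpha> \<noteq> 0" and "\<forall>x::'a. x \<noteq> 0 \<longrightarrow> (\<exists>i. x = \<alpha> ^ i)"
    and "1 \<le> h" and "h \<le> m - 1"
    and "e = (3 ^ h + 1) div 2"
  shows "(has_params3 (code_1e (3 ^ m - 1) \<alpha> e) (3 ^ m - 1) (3 ^ m - 1 - 2 * m) 4
            \<longleftrightarrow> odd h \<and> gcd m h = 1)
       \<and> (odd h \<and> gcd m h = 1 \<longleftrightarrow> planar (\<lambda>x::'a. x ^ e))"
proof -
  define n :: nat where "n = 3 ^ m - 1"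
  interpret ternary_generator \<alpha> m n
    by standard (use assms in \<open>simp_all add: n_def\<close>)
  \<comment> \<open>The bound on \<open>e\<close>, with \<open>e\<close> not a power of
    \<open>3\<close>, places \<open>e\<close> outside the cyclotomic coset of
    \<open>1\<close>.\<close>
  have "(1::nat) \<le> 3 ^ h" by simp
  hence "e \<le> 3 ^ h" using assms(7) by linarith
  also have "h < m" using assms(2,6) by simp
  hence "3 ^ h < n" using three_power_bound[of h] by simp
  finally have disj: "conjugates3 \<alpha> \<inter> conjugates3 (\<alpha> ^ e) = {}"
    using exponent_not_power_3[OF assms(7,5)] by (rule conjugates3_disjoint)
  have e0: "e > 0" using assms(7) by (simp add: div_greater_zero_iff Suc_le_eq)
  have "has_params3 (code_1e n \<alpha> e) n (n - 2 * m) 4 \<and> planar (\<lambda>x::'a. x ^ e)"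
    if "odd h" "gcd m h = 1"
  proof -
    have "planar (\<lambda>x::'a. x ^ e)"
      by (rule planar_power[OF card that(1) _ assms(7)])
        (use that(2) in \<open>simp add: coprime_iff_gcd_eq_1\<close>)
    moreover have "even e" using even_exponent_iff[OF assms(7)] that(1) by simp
    ultimately show ?thesis using planar_imp_params[OF _ _ e0 disj] by blast
  qed
  moreover have "\<not> has_params3 (code_1e n \<alpha> e) n (n - 2 * m) 4 \<and> \<not> planar (\<lambda>x::'a. x ^ e)"
    if "\<not> (odd h \<and> gcd m h = 1)"
  proof (cases "odd h")
    case True
    have "gcd m h \<noteq> 0" using assms(5) by simp
    hence "gcd m h > 1" using True that by linarith
    thus ?thesis using not_coprime_exponent[OF assms(7) _ disj] by (auto simp: has_params3_def)
  next
    case False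
    hence "odd e" using even_exponent_iff[OF assms(7)] by simp
    thus ?thesis using odd_exponent[OF _ disj] by (auto simp: has_params3_def)
  qed
  ultimately show ?thesis
    unfolding n_def[symmetric] by (cases "odd h \<and> gcd m h = 1") simp_all
qed

end
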